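(* Let $W$ be a finite reflection group with set of simple reflections $S$ and identity $e$. Then there exists a finite sequence of subsets $\{e\}=K_0,K_1,\dots,K_N=W$ of $W$ such that for each $i=0,1,\dots,N-1$ there is a simple reflection $s_i\in S$ with $K_{i+1}=K_i^+(s_i)$.
   Context: $W\subset\mathbf{GL}(n,\mathbb{R})$ is a finite group generated by reflections; $S$ is its set of simple reflections (reflections orthogonal to the simple roots with respect to a fixed ordered basis), which generates $W$. The length $\ell(w)$ of $w\in W$ is the minimum $k$ such that $w=s_1\cdots s_k$ with $s_j\in S$. For a reflection $t\in W$ define $t_+w=tw$ if $\ell(tw)<\ell(w)$ and $t_+w=w$ if $\ell(tw)\ge\ell(w)$. For $K\subseteq W$, $K^+(t):=\{w\in W:t_+w\in K\}$. *)

theory Defs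
  imports "HOL-Analysis.Analysis" "HOL-Algebra.Generated_Groups"
begin

definition GL :: "(real^'n^'n) monoid"
  where "GL = \<lparr>carrier = {A. invertible A}, monoid.mult = (**), one = mat 1\<rparr>"

lemma group_GL: "group (GL :: (real^'n^'n) monoid)"
proof (rule groupI)
  fix A :: "real^'n^'n"
  assume "A \<in> carrier GL"
  then obtain B where "A ** B = mat 1" "B ** A = mat 1"
    by (auto simp: GL_def invertible_def)
  then have "B \<in> carrier GL" "B \<otimes>\<^bsub>GL\<^esub> A = \<one>\<^bsub>GL\<^esub>"
    by (auto simp: GL_def invertible_def)
  then show "\<exists>B\<in>carrier GL. B \<otimes>\<^bsub>GL\<^esub> A = \<one>\<^bsub>GL\<^esub>"
    by blast
next
  show "\<one>\<^bsub>GL\<^esub> \<in> carrier (GL :: (real^'n^'n) monoid)"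
    unfolding GL_def invertible_def by (auto intro!: exI[of _ "mat 1"])
qed (auto simp: GL_def invertible_mult matrix_mul_assoc)

text \<open>The orthogonal reflection in the hyperplane \<open>v\<^sup>\<bottom>\<close> (for \<open>v \<noteq> 0\<close>).\<close>

definition reflection :: "real^'n \<Rightarrow> real^'n^'n"
  where "reflection v = matrix (\<lambda>x. x - (2 * (x \<bullet> v) / (v \<bullet> v)) *\<^sub>R v)"

definition finite_reflection_group :: "(real^'n^'n) set \<Rightarrow> bool"
  where "finite_reflection_group W \<longleftrightarrow>
    finite W \<and> (\<exists>V. 0 \<notin> V \<and> W = generate GL (reflection ` V))"

text \<open>Normalising the roots to unit length gives exactly two roots \<open>\<plusminus>v\<close> for each
  reflection in \<open>W\<close>.\<close>

definition roots :: "(real^'n^'n) set \<Rightarrow> (real^'n) set"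
  where "roots W = {v. norm v = 1 \<and> reflection v \<in> W}"

definition ordered_basis :: "(real^'n) list \<Rightarrow> bool"
  where "ordered_basis bs \<longleftrightarrow> distinct bs \<and> independent (set bs) \<and> span (set bs) = UNIV"

text \<open>Positivity for the lexicographic order: the first non-zero coordinate of \<open>v\<close> with
  respect to the ordered basis is positive.\<close>

definition lex_positive :: "(real^'n) list \<Rightarrow> real^'n \<Rightarrow> bool"
  where "lex_positive bs v \<longleftrightarrow>
    (\<exists>i < length bs. representation (set bs) v (bs ! i) > 0 \<and>
      (\<forall>j < i. representation (set bs) v (bs ! j) = 0))"

definition positive_roots :: "(real^'n) list \<Rightarrow> (real^'n^'n) set \<Rightarrow> (real^'n) set"
  where "positive_roots bs W = {v \<in> roots W. lex_positive bs v}"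

text \<open>A positive root is simple if it is not a linear combination, with non-negative
  coefficients, of the other positive roots.\<close>

definition simple_roots :: "(real^'n) list \<Rightarrow> (real^'n^'n) set \<Rightarrow> (real^'n) set"
  where "simple_roots bs W =
    {v \<in> positive_roots bs W. v \<notin> convex_cone hull (positive_roots bs W - {v})}"

definition simple_reflections :: "(real^'n) list \<Rightarrow> (real^'n^'n) set \<Rightarrow> (real^'n^'n) set"
  where "simple_reflections bs W = reflection ` simple_roots bs W"

text \<open>The length of \<open>w\<close>; it is meaningful when \<open>w\<close> lies in the group generated by the set
  \<open>S\<close> of involutions.\<close>

definition len :: "(real^'n^'n) set \<Rightarrow> real^'n^'n \<Rightarrow> nat"
  where "len S w =
    (LEAST k. \<exists>ss. length ss = k \<and> set ss \<subseteq> S \<and> w = foldr (**) ss (mat 1))"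

definition lower :: "(real^'n^'n) set \<Rightarrow> real^'n^'n \<Rightarrow> real^'n^'n \<Rightarrow> real^'n^'n"
  where "lower S t w = (if len S (t ** w) < len S w then t ** w else w)"

text \<open>\<open>lower S t w\<close> is $t_+w$, and \<open>plus_set W S K t\<close> is $K^+(t)$.\<close>

definition plus_set ::
    "(real^'n^'n) set \<Rightarrow> (real^'n^'n) set \<Rightarrow> (real^'n^'n) set \<Rightarrow> real^'n^'n \<Rightarrow> (real^'n^'n) set"
  where "plus_set W S K t = {w \<in> W. lower S t w \<in> K}"

end

theory Submission
  imports Defs
begin

text \<open>
  Call a composite \<open>F\<close> of maps \<open>lower S s\<close>, \<open>s \<in> S\<close>, collapsing if it is constantly the
  identity on \<open>W\<close>. If \<open>F w\<close> is not the identity for some \<open>w \<in> W\<close>, the first letter \<open>s\<close> of a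
  shortest word for \<open>F w\<close> makes \<open>lower S s\<close> strictly decrease the length of \<open>F w\<close>, and no
  length increases; hence the total length of the image drops, and some composite
  is collapsing. The sets \<open>K\<^sub>i\<close> are the preimages of the identity under the partial composites.

  The only input about reflection groups is that \<open>S\<close> generates \<open>W\<close>. The
  positive roots lie in the cone spanned by the simple ones, so every positive root \<open>\<beta>\<close>
  has positive inner product with some simple root \<open>\<alpha>\<close>; reflecting in \<open>\<alpha>\<close> gives
  a lexicographically smaller root, which is positive unless \<open>\<beta> = \<alpha>\<close>.
\<close>

section \<open>Generators of pointed cones\<close>

text \<open>The sums on the right already form a convex cone containing \<open>v\<close> and
  \<open>A\<close>, so minimality of the hull applies.\<close>

lemma convex_cone_hull_insertE:
  assumes "x \<in> convex_cone hull (insert v A)"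
  obtains a y where "a \<ge> 0" "y \<in> convex_cone hull A" "x = a *\<^sub>R v + y"
proof -
  let ?T = "{a *\<^sub>R v + y | a y. a \<ge> 0 \<and> y \<in> convex_cone hull A}"
  have "convex_cone ?T"
  proof (rule convex_cone_iff[THEN iffD2], intro conjI ballI allI impI)
    have "0 = 0 *\<^sub>R v + 0" by simp
    then show "0 \<in> ?T"
      using convex_cone_hull_contains_0 by blast
  next
    fix x y assume "x \<in> ?T" "y \<in> ?T"
    then obtain a x' b y' where *: "a \<ge> 0" "x' \<in> convex_cone hull A" "x = a *\<^sub>R v + x'"
      "b \<ge> 0" "y' \<in> convex_cone hull A" "y = b *\<^sub>R v + y'" by blast
    then have "x + y = (a + b) *\<^sub>R v + (x' + y')" by (simp add: algebra_simps)
    moreover have "a + b \<ge> 0" "x' + y' \<in> convex_cone hull A"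
      using * convex_cone_hull_add by auto
    ultimately show "x + y \<in> ?T" by blast
  next
    fix x and c :: real assume "x \<in> ?T" "c \<ge> 0"
    then obtain a x' where *: "a \<ge> 0" "x' \<in> convex_cone hull A" "x = a *\<^sub>R v + x'" by blast
    then have "c *\<^sub>R x = (c * a) *\<^sub>R v + c *\<^sub>R x'" by (simp add: algebra_simps)
    moreover have "c * a \<ge> 0" "c *\<^sub>R x' \<in> convex_cone hull A"
      using * \<open>c \<ge> 0\<close> convex_cone_hull_mul by auto
    ultimately show "c *\<^sub>R x \<in> ?T" by blast
  qed
  moreover have "insert v A \<subseteq> ?T"
  proof
    fix x assume "x \<in> insert v A"
    then consider "x = 1 *\<^sub>R v + 0" | "x \<in> A" by auto
    then show "x \<in> ?T"
    proof cases
      case 1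
      then show ?thesis using convex_cone_hull_contains_0 zero_le_one by blast
    next
      case 2
      then have "x = 0 *\<^sub>R v + x" "x \<in> convex_cone hull A" by (auto intro: hull_inc)
      then show ?thesis by blast
    qed
  qed
  ultimately have "x \<in> ?T"
    using assms hull_minimal[of "insert v A" ?T convex_cone] by blast
  then show thesis using that by blast
qed

text \<open>Redundant generators are discarded one at a time; pointedness ensures that a generator
  irredundant after a removal was irredundant before it. The last assumption allows one generator
  per ray: two on a common ray would each make the other redundant, and both would be lost.\<close>

lemma pointed_cone_generators:
  fixes P :: "'a::real_vector set"
  assumes "finite P" and C: "convex_cone C" and pointed: "\<And>x. x \<in> C \<Longrightarrow> - x \<in> C \<Longrightarrow> x = 0"
    and "P \<subseteq> C" "0 \<notin> P"
    and "\<And>x y c. x \<in> P \<Longrightarrow> y \<in> P \<Longrightarrow> c \<ge> 0 \<Longrightarrow> x = c *\<^sub>R y \<Longrightarrow> x = y"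
  shows "P \<subseteq> convex_cone hull {v \<in> P. v \<notin> convex_cone hull (P - {v})}"
  using assms(1,4-)
proof (induction P rule: finite_psubset_induct)
  case (psubset P)
  let ?\<Delta> = "\<lambda>P. {v \<in> P. v \<notin> convex_cone hull (P - {v})}"
  show ?case
  proof (cases "?\<Delta> P = P")
    case True
    then show ?thesis by (simp add: hull_subset)
  next
    case False
    then obtain v where v: "v \<in> P" "v \<in> convex_cone hull (P - {v})" by blast
    let ?P = "P - {v}"
    have IH: "?P \<subseteq> convex_cone hull (?\<Delta> ?P)"
    proof (rule psubset.IH)
      fix x y c assume "x \<in> ?P" "y \<in> ?P" "(c::real) \<ge> 0" "x = c *\<^sub>R y"
      then show "x = y" using psubset.prems(3)[of x y c] by blast
    qed (use v psubset.prems in auto)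
    \<comment> \<open>If \<open>u\<close> became redundant once \<open>v\<close> is restored, its
      expression would involve \<open>v\<close>, while that of \<open>v\<close> may involve
      \<open>u\<close>. Substituting one into the other gives (1 - a b) u = a y + x, with the right
      side in the cone \<open>?H\<close> on the remaining generators.\<close>
    have "?\<Delta> ?P \<subseteq> ?\<Delta> P"
    proof
      fix u assume u: "u \<in> ?\<Delta> ?P"
      let ?H = "convex_cone hull (?P - {u})"
      have "?H \<subseteq> C"
        using psubset.prems(1) C by (intro hull_minimal) auto
      have "u \<notin> convex_cone hull (P - {u})"
      proof
        assume "u \<in> convex_cone hull (P - {u})"
        moreover have "P - {u} = insert v (?P - {u})" using u v by auto
        ultimately obtain a x where a: "a \<ge> 0" "x \<in> ?H" "u = a *\<^sub>R v + x"
          using convex_cone_hull_insertE by metis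
        have "?P = insert u (?P - {u})" using u by auto
        then obtain b y where b: "b \<ge> 0" "y \<in> ?H" "v = b *\<^sub>R u + y"
          using convex_cone_hull_insertE v(2) by metis
        have eq: "(1 - a * b) *\<^sub>R u = a *\<^sub>R y + x"
        proof -
          have "a *\<^sub>R (b *\<^sub>R u + y) + x = u"
            by (simp only: a(3)[symmetric] b(3)[symmetric])
          then show ?thesis by (simp add: algebra_simps)
        qed
        have ayx: "a *\<^sub>R y \<in> ?H" "a *\<^sub>R y + x \<in> ?H"
          using a(1,2) b(1,2) by (auto intro: convex_cone_hull_add convex_cone_hull_mul)
        show False
        proof (cases "a * b < 1")
          case True
          then have "u = (1 / (1 - a * b)) *\<^sub>R ((1 - a * b) *\<^sub>R u)" by simp
          also have "\<dots> \<in> ?H"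
            unfolding eq using ayx True by (intro convex_cone_hull_mul) auto
          finally show False using u by auto
        next
          \<comment> \<open>Here -(a y + x) is a non-negative multiple of \<open>u\<close>, hence in
            \<open>C\<close>. Pointedness kills the sum and then \<open>a *\<^sub>R y\<close>, which
            puts \<open>v\<close> on the ray of \<open>u\<close>.\<close>
          case False
          have "- (a *\<^sub>R y + x) = (a * b - 1) *\<^sub>R u"
            unfolding eq[symmetric] by (simp add: algebra_simps)
          also have "\<dots> \<in> C"
            using False C u psubset.prems(1) by (intro convex_cone_scaleR) auto
          finally have "a *\<^sub>R y + x = 0"
            using pointed ayx \<open>?H \<subseteq> C\<close> by blast
          then have "- (a *\<^sub>R y) = x" by (simp add: add_eq_0_iff)
          then have "a *\<^sub>R y = 0"
            using pointed[of "a *\<^sub>R y"] ayx a(2) \<open>?H \<subseteq> C\<close> by auto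
          moreover have "a \<noteq> 0" using False by auto
          ultimately have "v = b *\<^sub>R u" using b(3) by simp
          then show False
            using psubset.prems(3)[of v u b] b(1) v u by auto
        qed
      qed
      then show "u \<in> ?\<Delta> P" using u by auto
    qed
    then have sub: "?P \<subseteq> convex_cone hull (?\<Delta> P)"
      using IH hull_mono by blast
    then have "convex_cone hull ?P \<subseteq> convex_cone hull (?\<Delta> P)"
      by (intro hull_minimal convex_cone_convex_cone_hull)
    then show ?thesis using sub v by blast
  qed
qed

section \<open>Lexicographic positivity\<close>

lemma lex_positive_0: "\<not> lex_positive bs 0"
  by (simp add: lex_positive_def real_vector.representation_zero)

lemma lex_positive_scaleR:
  assumes "ordered_basis bs" "lex_positive bs v" "c > 0"
  shows "lex_positive bs (c *\<^sub>R v)"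
  using assms
  by (auto simp: lex_positive_def ordered_basis_def real_vector.representation_scale)

lemma lex_positive_add:
  assumes "ordered_basis bs" "lex_positive bs u" "lex_positive bs v"
  shows "lex_positive bs (u + v)"
proof -
  let ?r = "\<lambda>v i. representation (set bs) v (bs ! i)"
  have add: "?r (u + v) i = ?r u i + ?r v i" for i
    using assms(1) by (simp add: ordered_basis_def real_vector.representation_add)
  obtain i where i: "i < length bs" "?r u i > 0" "\<forall>j<i. ?r u j = 0"
    using assms(2) by (auto simp: lex_positive_def)
  obtain k where k: "k < length bs" "?r v k > 0" "\<forall>j<k. ?r v j = 0"
    using assms(3) by (auto simp: lex_positive_def)
  \<comment> \<open>The earlier of the two leading coordinates leads the sum; if they coincide, two
    positive numbers cannot cancel.\<close>
  have "?r (u + v) (min i k) > 0"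
    using i k by (cases i k rule: linorder_cases) (auto simp: add min_def)
  then show ?thesis
    using i k unfolding lex_positive_def
    by (intro exI[of _ "min i k"]) (auto simp: add)
qed

text \<open>A non-zero vector has a first non-zero coordinate, and negation flips its sign.\<close>

lemma lex_positive_total:
  assumes "ordered_basis bs" "v \<noteq> 0"
  shows "lex_positive bs v \<or> lex_positive bs (- v)"
proof -
  let ?r = "\<lambda>v i. representation (set bs) v (bs ! i)"
  have basis: "independent (set bs)" "v \<in> span (set bs)"
    using assms(1) by (auto simp: ordered_basis_def)
  have "\<exists>i<length bs. ?r v i \<noteq> 0"
  proof (rule ccontr)
    assume "\<not> ?thesis"
    then have "representation (set bs) v b = 0" if "b \<in> set bs" for b
      using that by (auto simp: in_set_conv_nth)
    then have "(\<Sum>b\<in>set bs. representation (set bs) v b *\<^sub>R b) = 0"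
      by simp
    then show False
      using real_vector.sum_representation_eq[OF basis] assms(2) by simp
  qed
  then obtain i where i: "i < length bs" "?r v i \<noteq> 0" "\<forall>j<i. j < length bs \<longrightarrow> ?r v j = 0"
    using exists_least_iff[of "\<lambda>i. i < length bs \<and> ?r v i \<noteq> 0"] by blast
  then have z: "\<forall>j<i. ?r v j = 0" by auto
  have neg: "?r (- v) j = - ?r v j" for j
    using basis by (simp add: real_vector.representation_neg)
  show ?thesis
    using i(1,2) z unfolding lex_positive_def neg
    by (cases "?r v i > 0") (auto intro!: exI[of _ i])
qed

lemma lex_positive_asym:
  assumes "ordered_basis bs" "lex_positive bs v"
  shows "\<not> lex_positive bs (- v)"
  using lex_positive_add[OF assms, of "- v"] lex_positive_0 by auto

text \<open>Zero is adjoined because a convex cone contains it although it is not lexicographically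
  positive. This is the pointed cone in which the positive roots live.\<close>

lemma convex_cone_lex_positive:
  assumes "ordered_basis bs"
  shows "convex_cone (insert 0 {v. lex_positive bs v})"
  using lex_positive_add[OF assms] lex_positive_scaleR[OF assms]
  by (auto simp: convex_cone_iff less_le)

section \<open>Reflections and roots\<close>

lemma linear_reflection: "linear (\<lambda>x. x - (2 * (x \<bullet> v) / (v \<bullet> v)) *\<^sub>R v)"
  by (rule linearI) (simp_all add: inner_add_left algebra_simps add_divide_distrib)

lemma reflection_vector: "reflection v *v x = x - (2 * (x \<bullet> v) / (v \<bullet> v)) *\<^sub>R v"
  unfolding reflection_def
  by (rule fun_cong[OF matrix_vector_mul(2)[OF linear_reflection]])

lemma reflection_scaleR:
  assumes "c \<noteq> 0"
  shows "reflection (c *\<^sub>R v) = reflection v"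
  using assms by (simp add: matrix_eq reflection_vector field_simps)

lemma reflection_uminus: "reflection (- v) = reflection v"
  using reflection_scaleR[of "-1" v] by simp

text \<open>The component along \<open>v\<close> changes sign twice. For \<open>v = 0\<close>,
  division by zero yields 0 and \<open>reflection v\<close> is the identity.\<close>

lemma reflection_involution_vector: "reflection v *v (reflection v *v x) = x"
proof (cases "v = 0")
  case False
  let ?a = "2 * (x \<bullet> v) / (v \<bullet> v)"
  have "2 * ((x - ?a *\<^sub>R v) \<bullet> v) / (v \<bullet> v) = - ?a"
    using False by (simp add: inner_diff_left field_simps)
  then show ?thesis by (simp add: reflection_vector)
qed (simp add: reflection_vector)

lemma reflection_involution: "reflection v ** reflection v = mat 1"
  by (simp add: matrix_eq reflection_involution_vector flip: matrix_vector_mul_assoc)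

lemma inner_reflection_left: "(reflection v *v x) \<bullet> y = x \<bullet> (reflection v *v y)"
  by (simp add: reflection_vector inner_diff_left inner_diff_right inner_commute)

lemma inner_reflection: "(reflection v *v x) \<bullet> (reflection v *v y) = x \<bullet> y"
  by (simp add: inner_reflection_left reflection_involution_vector)

text \<open>An isometry carries a mirror to the mirror of the image vector;
  \<open>reflection u\<close> also serves as its own inverse. Hence reflecting a root in a root
  gives a root.\<close>

lemma reflection_conj:
  "reflection (reflection u *v v) = reflection u ** reflection v ** reflection u"
proof (unfold matrix_eq, intro allI)
  fix x
  let ?r = "\<lambda>x. reflection u *v x"
  have "?r (reflection v *v ?r x) = ?r (?r x) - (2 * (?r x \<bullet> v) / (v \<bullet> v)) *\<^sub>R ?r v"
    unfolding reflection_vector[of v]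
    by (simp add: matrix_vector_mult_diff_distrib matrix_vector_mult_scaleR)
  then show "reflection (?r v) *v x = (reflection u ** reflection v ** reflection u) *v x"
    by (simp add: reflection_vector[of "?r v"] inner_reflection inner_reflection_left
        reflection_involution_vector flip: matrix_vector_mul_assoc)
qed

text \<open>Applying both reflections to \<open>u\<close> shows that \<open>u\<close> is a multiple
  of \<open>v\<close>; the norms leave only the sign free.\<close>

lemma reflection_eq_iff:
  assumes "norm u = 1" "norm v = 1"
  shows "reflection u = reflection v \<longleftrightarrow> u = v \<or> u = - v"
proof
  assume eq: "reflection u = reflection v"
  have uu: "u \<bullet> u = 1" and vv: "v \<bullet> v = 1" using assms by (simp_all add: norm_eq_1)
  have "- u = u - (2 * (u \<bullet> v)) *\<^sub>R v"
    using arg_cong[OF eq, of "\<lambda>A. A *v u"] by (simp add: reflection_vector uu vv scaleR_2)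
  then have "2 *\<^sub>R u = 2 *\<^sub>R ((u \<bullet> v) *\<^sub>R v)"
    by (simp add: scaleR_2 algebra_simps)
  then have u: "u = (u \<bullet> v) *\<^sub>R v"
    by (simp only: scaleR_cancel_left) simp
  then have "\<bar>u \<bullet> v\<bar> = 1"
    by (metis assms norm_scaleR mult.right_neutral)
  then show "u = v \<or> u = - v"
    by (metis u abs_eq_iff' scaleR_one scaleR_minus1_left abs_1)
qed (auto simp: reflection_uminus)

section \<open>Closure of \<open>W\<close> under products, finiteness and stability of its
  roots\<close>

lemma generate_GL_mult:
  assumes "A \<in> generate GL X" "B \<in> generate GL X"
  shows "A ** B \<in> generate GL X"
  using generate.eng[OF assms] by (simp add: GL_def)

lemma finite_reflection_group_mult:
  assumes "finite_reflection_group W" "A \<in> W" "B \<in> W"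
  shows "A ** B \<in> W"
  using assms generate_GL_mult by (auto simp: finite_reflection_group_def)

lemma finite_reflection_group_one:
  assumes "finite_reflection_group W"
  shows "mat 1 \<in> W"
  using assms generate.one[of GL] by (auto simp: finite_reflection_group_def GL_def)

text \<open>Each reflection in \<open>W\<close> comes from at most two unit vectors.\<close>

lemma finite_roots:
  assumes "finite W"
  shows "finite (roots W)"
proof (rule finite_finite_vimage_IntI[of W reflection, THEN finite_subset[rotated]])
  show "finite (reflection -` {y} \<inter> {v. norm v = 1})" for y :: "real^'n^'n"
  proof (cases "reflection -` {y} \<inter> {v. norm v = 1} = {}")
    case False
    then obtain u where "reflection u = y" "norm u = 1" by auto
    then have "v = u \<or> v = - u" if "v \<in> reflection -` {y} \<inter> {v. norm v = 1}" for v
      using that reflection_eq_iff[of v u] by simp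
    then have "reflection -` {y} \<inter> {v. norm v = 1} \<subseteq> {u, - u}" by blast
    then show ?thesis by (rule finite_subset) simp
  qed (metis finite.emptyI)
qed (use assms in \<open>auto simp: roots_def\<close>)

lemma finite_positive_roots:
  assumes "finite_reflection_group W"
  shows "finite (positive_roots bs W)"
proof (rule finite_subset)
  show "positive_roots bs W \<subseteq> roots W" by (auto simp: positive_roots_def)
  show "finite (roots W)"
    using assms by (intro finite_roots) (simp add: finite_reflection_group_def)
qed

lemma reflection_root_in_roots:
  assumes "finite_reflection_group W" "u \<in> roots W" "v \<in> roots W"
  shows "reflection u *v v \<in> roots W"
  using assms finite_reflection_group_mult[OF assms(1)]
  by (auto simp: roots_def reflection_conj norm_eq_1 inner_reflection)

lemma uminus_in_roots: "v \<in> roots W \<Longrightarrow> - v \<in> roots W"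
  by (simp add: roots_def reflection_uminus)

lemma inv_reflection_GL: "inv\<^bsub>GL\<^esub> (reflection v) = reflection v"
proof -
  have "reflection v \<in> carrier GL"
    using reflection_involution[of v] by (auto simp: GL_def invertible_def)
  then show ?thesis
    using reflection_involution[of v]
    by (intro group.inv_equality[OF group_GL]) (auto simp: GL_def)
qed

section \<open>Simple reflections generate\<close>

lemma simple_rootsD:
  assumes "v \<in> simple_roots bs W"
  shows "v \<in> roots W" "lex_positive bs v" "norm v = 1" "v \<bullet> v = 1" "reflection v \<in> W"
  using assms by (auto simp: simple_roots_def positive_roots_def roots_def norm_eq_1)

text \<open>The cone lemma applies because the lexicographic cone is pointed and unit length leaves
  at most one root on each ray.\<close>

lemma positive_roots_subset_cone_simple_roots:
  assumes W: "finite_reflection_group W" and bs: "ordered_basis bs"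
  shows "positive_roots bs W \<subseteq> convex_cone hull (simple_roots bs W)"
  unfolding simple_roots_def
proof (rule pointed_cone_generators[OF _ convex_cone_lex_positive[OF bs]])
  show "finite (positive_roots bs W)"
    using finite_positive_roots[OF W] .
  show "x = 0" if "x \<in> insert 0 {v. lex_positive bs v}" "- x \<in> insert 0 {v. lex_positive bs v}" for x
    using that lex_positive_asym[OF bs] by auto
  show "x = y" if "x \<in> positive_roots bs W" "y \<in> positive_roots bs W" "c \<ge> 0" "x = c *\<^sub>R y" for x y c
    using that by (auto simp: positive_roots_def roots_def)
qed (auto simp: positive_roots_def roots_def)

text \<open>Otherwise a half-space would contain all simple roots, hence the cone they span and
  \<beta> itself, forcing \<beta> \<bullet> \<beta> \<le> 0.\<close>

lemma ex_simple_root_inner_pos: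
  assumes W: "finite_reflection_group W" and bs: "ordered_basis bs"
    and \<beta>: "\<beta> \<in> positive_roots bs W"
  shows "\<exists>\<alpha>\<in>simple_roots bs W. \<beta> \<bullet> \<alpha> > 0"
proof (rule ccontr)
  assume "\<not> ?thesis"
  then have "simple_roots bs W \<subseteq> {x. \<beta> \<bullet> x \<le> 0}" by force
  then have "convex_cone hull (simple_roots bs W) \<subseteq> {x. \<beta> \<bullet> x \<le> 0}"
    by (intro hull_minimal convex_cone_halfspace_le)
  then have "\<beta> \<bullet> \<beta> \<le> 0"
    using positive_roots_subset_cone_simple_roots[OF W bs] \<beta> by blast
  then show False
    using \<beta> by (auto simp: positive_roots_def roots_def norm_eq_1)
qed

text \<open>If the reflected root were negative, \<open>\<alpha>\<close> would be a positive combination of \<open>\<beta>\<close> and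
  the negated image.\<close>

lemma simple_reflection_positive_root:
  assumes W: "finite_reflection_group W" and bs: "ordered_basis bs"
    and \<alpha>: "\<alpha> \<in> simple_roots bs W" and \<beta>: "\<beta> \<in> positive_roots bs W"
    and "\<beta> \<noteq> \<alpha>" "\<beta> \<bullet> \<alpha> > 0"
  shows "reflection \<alpha> *v \<beta> \<in> positive_roots bs W"
proof (rule ccontr)
  let ?\<gamma> = "- (reflection \<alpha> *v \<beta>)" and ?c = "2 * (\<beta> \<bullet> \<alpha>)"
  assume neg: "\<not> ?thesis"
  note \<alpha>' = simple_rootsD[OF \<alpha>]
  have root: "reflection \<alpha> *v \<beta> \<in> roots W"
    using reflection_root_in_roots[OF W] \<alpha>' \<beta> by (auto simp: positive_roots_def)
  then have "reflection \<alpha> *v \<beta> \<noteq> 0" by (auto simp: roots_def)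
  then have \<gamma>: "?\<gamma> \<in> positive_roots bs W"
    using neg root lex_positive_total[OF bs] uminus_in_roots by (auto simp: positive_roots_def)
  have r: "reflection \<alpha> *v \<beta> = \<beta> - ?c *\<^sub>R \<alpha>"
    by (simp add: reflection_vector \<alpha>')
  \<comment> \<open>Simplicity of \<alpha> speaks only of the cone on the other positive roots, so
    neither summand may be \<alpha> itself.\<close>
  have "?\<gamma> \<noteq> \<alpha>"
  proof
    assume "?\<gamma> = \<alpha>"
    then have "reflection \<alpha> *v ?\<gamma> = reflection \<alpha> *v \<alpha>" by simp
    moreover have "reflection \<alpha> *v ?\<gamma> = - \<beta>"
      using matrix_vector_mult_scaleR[of "reflection \<alpha>" "-1" "reflection \<alpha> *v \<beta>"]
      by (simp add: reflection_involution_vector)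
    moreover have "reflection \<alpha> *v \<alpha> = - \<alpha>"
      by (simp add: reflection_vector \<alpha>' scaleR_2)
    ultimately have "- \<beta> = - \<alpha>" by simp
    then show False using \<open>\<beta> \<noteq> \<alpha>\<close> by simp
  qed
  then have "\<beta> + ?\<gamma> \<in> convex_cone hull (positive_roots bs W - {\<alpha>})"
    using \<beta> \<gamma> \<open>\<beta> \<noteq> \<alpha>\<close> by (intro convex_cone_hull_add) (auto intro: hull_inc)
  \<comment> \<open>Since \<beta> + \<open>?\<gamma>\<close> = \<open>?c *\<^sub>R \<alpha>\<close>,
    this vector is \<alpha>.\<close>
  then have "(1 / ?c) *\<^sub>R (\<beta> + ?\<gamma>) \<in> convex_cone hull (positive_roots bs W - {\<alpha>})"
    using \<open>\<beta> \<bullet> \<alpha> > 0\<close> by (intro convex_cone_hull_mul) auto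
  then show False
    using \<alpha> \<open>\<beta> \<bullet> \<alpha> > 0\<close> by (simp add: r simple_roots_def)
qed

text \<open>The lexicographic descent terminates because only finitely many positive roots lie below
  \<beta>; their number is the induction measure. Conjugation by \<open>reflection \<alpha>\<close>
  recovers the reflection in \<beta> from that in the smaller root.\<close>

lemma reflection_in_generate_simple:
  assumes W: "finite_reflection_group W" and bs: "ordered_basis bs"
    and "\<beta> \<in> positive_roots bs W"
  shows "reflection \<beta> \<in> generate GL (simple_reflections bs W)"
  using assms(3)
proof (induction "card {\<gamma> \<in> positive_roots bs W. lex_positive bs (\<beta> - \<gamma>)}"
    arbitrary: \<beta> rule: less_induct)
  case less
  let ?P = "positive_roots bs W" and ?G = "generate GL (simple_reflections bs W)"
  obtain \<alpha> where \<alpha>: "\<alpha> \<in> simple_roots bs W" "\<beta> \<bullet> \<alpha> > 0"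
    using ex_simple_root_inner_pos[OF W bs less.prems] by blast
  note \<alpha>' = simple_rootsD[OF \<alpha>(1)]
  have s: "reflection \<alpha> \<in> ?G"
    using \<alpha>(1) by (auto simp: simple_reflections_def intro: generate.incl)
  show ?case
  proof (cases "\<beta> = \<alpha>")
    case False
    let ?\<delta> = "reflection \<alpha> *v \<beta>"
    have \<delta>: "?\<delta> \<in> ?P"
      using simple_reflection_positive_root[OF W bs \<alpha>(1) less.prems False \<alpha>(2)] .
    have "\<beta> - ?\<delta> = (2 * (\<beta> \<bullet> \<alpha>)) *\<^sub>R \<alpha>"
      by (simp add: reflection_vector \<alpha>')
    then have smaller: "lex_positive bs (\<beta> - ?\<delta>)"
      using lex_positive_scaleR[OF bs] \<alpha>' \<alpha>(2) by simp
    \<comment> \<open>The inclusion is strict because \<open>?\<delta>\<close> lies below \<beta>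
      but not below itself.\<close>
    have "{\<gamma> \<in> ?P. lex_positive bs (?\<delta> - \<gamma>)} \<subset> {\<gamma> \<in> ?P. lex_positive bs (\<beta> - \<gamma>)}"
    proof (rule psubsetI)
      show "{\<gamma> \<in> ?P. lex_positive bs (?\<delta> - \<gamma>)} \<subseteq> {\<gamma> \<in> ?P. lex_positive bs (\<beta> - \<gamma>)}"
        using lex_positive_add[OF bs smaller] by fastforce
      show "{\<gamma> \<in> ?P. lex_positive bs (?\<delta> - \<gamma>)} \<noteq> {\<gamma> \<in> ?P. lex_positive bs (\<beta> - \<gamma>)}"
        using \<delta> smaller lex_positive_0[of bs]
        by (metis (mono_tags, lifting) diff_self mem_Collect_eq)
    qed
    moreover have "finite ?P"
      using finite_positive_roots[OF W] .
    ultimately have "reflection ?\<delta> \<in> ?G"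
      using less.hyps[OF psubset_card_mono \<delta>] by simp
    then have "reflection \<alpha> ** reflection ?\<delta> ** reflection \<alpha> \<in> ?G"
      using s by (intro generate_GL_mult)
    moreover have "reflection \<alpha> ** reflection ?\<delta> ** reflection \<alpha> = reflection \<beta>"
      by (simp add: reflection_involution_vector flip: reflection_conj)
    ultimately show ?thesis by simp
  qed (use s in simp)
qed

text \<open>Rescaling a generating vector to unit length and choosing its sign makes it a positive
  root without changing its reflection.\<close>

lemma finite_reflection_group_subset_generate_simple:
  assumes W: "finite_reflection_group W" and bs: "ordered_basis bs"
  shows "W \<subseteq> generate GL (simple_reflections bs W)"
proof -
  let ?G = "generate GL (simple_reflections bs W)"
  obtain V where V: "0 \<notin> V" "W = generate GL (reflection ` V)"
    using W by (auto simp: finite_reflection_group_def)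
  have gen: "reflection v \<in> ?G" if "v \<in> V" for v
  proof -
    let ?u = "(1 / norm v) *\<^sub>R v"
    have "v \<noteq> 0" using that V by auto
    then have u: "reflection ?u = reflection v" "norm ?u = 1"
      by (auto intro: reflection_scaleR)
    then have root: "?u \<in> roots W"
      using that V by (auto simp: roots_def intro: generate.incl)
    have "?u \<noteq> 0" using \<open>v \<noteq> 0\<close> by simp
    then consider "?u \<in> positive_roots bs W" | "- ?u \<in> positive_roots bs W"
      using lex_positive_total[OF bs] root uminus_in_roots unfolding positive_roots_def by blast
    then show ?thesis
      using reflection_in_generate_simple[OF W bs] u(1) by (metis reflection_uminus)
  qed
  show ?thesis
  proof
    fix w assume "w \<in> W"
    then have "w \<in> generate GL (reflection ` V)" by (simp add: V(2))
    then show "w \<in> ?G"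
      by (induction rule: generate.induct)
        (auto simp: inv_reflection_GL intro: gen generate.one generate.eng)
  qed
qed

section \<open>Words in the simple reflections\<close>

lemma foldr_matrix_mult_append:
  fixes xs ys :: "(real^'n^'n) list"
  shows "foldr (**) (xs @ ys) (mat 1) = foldr (**) xs (mat 1) ** foldr (**) ys (mat 1)"
  by (induction xs) (auto simp: matrix_mul_assoc)

text \<open>\<open>generate\<close> admits inverses of generators, but simple reflections are
  involutions, so plain words suffice. Thus the minimum in \<open>len\<close> is attained on
  \<open>W\<close>.\<close>

lemma simple_reflections_word:
  assumes W: "finite_reflection_group W" and bs: "ordered_basis bs" and "w \<in> W"
  shows "\<exists>ss. set ss \<subseteq> simple_reflections bs W \<and> w = foldr (**) ss (mat 1)"
proof -
  let ?S = "simple_reflections bs W"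
  have "w \<in> generate GL ?S"
    using finite_reflection_group_subset_generate_simple[OF W bs] \<open>w \<in> W\<close> by blast
  then show ?thesis
  proof (induction rule: generate.induct)
    case one
    show ?case by (rule exI[of _ "[]"]) (simp add: GL_def)
  next
    case (incl s)
    then show ?case by (intro exI[of _ "[s]"]) simp
  next
    case (inv s)
    then have "inv\<^bsub>GL\<^esub> s = s" by (auto simp: simple_reflections_def inv_reflection_GL)
    then show ?case using inv by (intro exI[of _ "[s]"]) simp
  next
    case (eng x y)
    then obtain xs ys where "set xs \<subseteq> ?S" "set ys \<subseteq> ?S"
      "x = foldr (**) xs (mat 1)" "y = foldr (**) ys (mat 1)" by blast
    then show ?case
      by (intro exI[of _ "xs @ ys"]) (simp add: GL_def flip: foldr_matrix_mult_append)
  qed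
qed

section \<open>Lowering\<close>

lemma len_le:
  assumes "set ss \<subseteq> S"
  shows "len S (foldr (**) ss (mat 1)) \<le> length ss"
  unfolding len_def using assms by (intro Least_le) auto

lemma len_word:
  assumes "\<exists>ss. set ss \<subseteq> S \<and> w = foldr (**) ss (mat 1)"
  obtains ss where "length ss = len S w" "set ss \<subseteq> S" "w = foldr (**) ss (mat 1)"
  using LeastI_ex[of "\<lambda>k. \<exists>ss. length ss = k \<and> set ss \<subseteq> S \<and> w = foldr (**) ss (mat 1)"] assms
  unfolding len_def by blast

lemma len_lower_le: "len S (lower S t w) \<le> len S w"
  by (simp add: lower_def)

lemma ex_len_lower_less:
  assumes "\<exists>ss. set ss \<subseteq> S \<and> w = foldr (**) ss (mat 1)" "w \<noteq> mat 1"
    and inv: "\<And>s. s \<in> S \<Longrightarrow> s ** s = mat 1"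
  shows "\<exists>s\<in>S. len S (lower S s w) < len S w"
proof -
  obtain ss where ss: "length ss = len S w" "set ss \<subseteq> S" "w = foldr (**) ss (mat 1)"
    using len_word[OF assms(1)] .
  with assms(2) obtain s rest where c: "ss = s # rest" by (cases ss) auto
  \<comment> \<open>The involution \<open>s\<close> cancels the leading letter, leaving a word one
    letter shorter than a shortest word for \<open>w\<close>.\<close>
  then have "s ** w = foldr (**) rest (mat 1)"
    using ss inv by (simp add: matrix_mul_assoc)
  then have "len S (s ** w) < len S w"
    using len_le[of rest S] ss c by auto
  then show ?thesis using ss c by (auto simp: lower_def)
qed

text \<open>The map \<open>F\<close> is arbitrary so that the induction on total length can absorb
  each further lowering map into it; the case of interest is \<open>F = id\<close>.\<close>

lemma ex_collapsing_sequence: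
  assumes "finite W" "W \<noteq> {}"
    and words: "\<And>w. w \<in> W \<Longrightarrow> \<exists>ss. set ss \<subseteq> S \<and> w = foldr (**) ss (mat 1)"
    and inv: "\<And>s. s \<in> S \<Longrightarrow> s ** s = mat 1"
    and closed: "\<And>s w. s \<in> S \<Longrightarrow> w \<in> W \<Longrightarrow> s ** w \<in> W"
    and F: "F ` W \<subseteq> W"
  shows "\<exists>ss. set ss \<subseteq> S \<and> (\<forall>w\<in>W. foldr (lower S) ss (F w) = mat 1)"
  using F
proof (induction "\<Sum>w\<in>W. len S (F w)" arbitrary: F rule: less_induct)
  case less
  show ?case
  proof (cases "\<forall>w\<in>W. F w = mat 1")
    case True
    then show ?thesis by (intro exI[of _ "[]"]) simp
  next
    case False
    then obtain w where w: "w \<in> W" "F w \<noteq> mat 1" by blast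
    then obtain s where s: "s \<in> S" "len S (lower S s (F w)) < len S (F w)"
      using ex_len_lower_less[OF words _ inv, of "F w"] less.prems by blast
    have "(\<Sum>w\<in>W. len S (lower S s (F w))) < (\<Sum>w\<in>W. len S (F w))"
      using \<open>finite W\<close> w s by (intro sum_strict_mono_ex1) (auto simp: len_lower_le)
    moreover have "(\<lambda>w. lower S s (F w)) ` W \<subseteq> W"
      using less.prems closed s by (auto simp: lower_def)
    ultimately obtain ss where "set ss \<subseteq> S" "\<forall>w\<in>W. foldr (lower S) ss (lower S s (F w)) = mat 1"
      using less.hyps[of "\<lambda>w. lower S s (F w)"] by auto
    \<comment> \<open>\<open>foldr\<close> applies the last letter first, so \<open>s\<close>, which
      acts directly after \<open>F\<close>, goes at the end.\<close>
    then show ?thesis using s by (intro exI[of _ "ss @ [s]"]) simp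
  qed
qed

theorem theorem4p12:
  fixes W :: "(real^'n^'n) set" and bs :: "(real^'n) list"
  assumes "finite_reflection_group W"
    and "ordered_basis bs"
  defines "S \<equiv> simple_reflections bs W"
  shows "\<exists>(N::nat) (K :: nat \<Rightarrow> (real^'n^'n) set).
    (\<forall>i\<le>N. K i \<subseteq> W) \<and> K 0 = {mat 1} \<and> K N = W \<and>
    (\<forall>i<N. \<exists>s\<in>S. K (Suc i) = plus_set W S (K i) s)"
proof -
  have one: "mat 1 \<in> W" using finite_reflection_group_one[OF assms(1)] .
  have inv: "s ** s = mat 1" if "s \<in> S" for s
    using that by (auto simp: S_def simple_reflections_def reflection_involution)
  have closed: "s ** w \<in> W" if "s \<in> S" "w \<in> W" for s w
    using that by (auto simp: S_def simple_reflections_def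
        intro!: finite_reflection_group_mult[OF assms(1)] simple_rootsD(5))
  have "\<exists>ss. set ss \<subseteq> S \<and> (\<forall>w\<in>W. foldr (lower S) ss (id w) = mat 1)"
  proof (rule ex_collapsing_sequence)
    show "finite W" using assms(1) by (simp add: finite_reflection_group_def)
    show "\<exists>ss. set ss \<subseteq> S \<and> w = foldr (**) ss (mat 1)" if "w \<in> W" for w
      using simple_reflections_word[OF assms(1,2) that] by (simp add: S_def)
  qed (use one inv closed in auto)
  then obtain ss where ss: "set ss \<subseteq> S" "\<And>w. w \<in> W \<Longrightarrow> foldr (lower S) ss w = mat 1"
    by auto
  \<comment> \<open>Prefixes are the right truncations: in \<open>take (Suc i) ss\<close> the new
    letter \<open>ss ! i\<close> acts first, so \<open>w\<close> lies in \<open>K (Suc i)\<close>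
    exactly when its lowering by \<open>ss ! i\<close> lies in \<open>K i\<close>. The empty prefix
    acts as the identity map and the full one collapses \<open>W\<close>.\<close>
  define K where "K i = {w \<in> W. foldr (lower S) (take i ss) w = mat 1}" for i
  have step: "K (Suc i) = plus_set W S (K i) (ss ! i)" if "i < length ss" for i
  proof -
    \<comment> \<open>Membership in \<open>K i\<close> includes membership in \<open>W\<close>, so
      lowering must not leave the group.\<close>
    have "lower S (ss ! i) w \<in> W" if "w \<in> W" for w
    proof -
      have "ss ! i \<in> S" using \<open>i < length ss\<close> ss(1) by auto
      then show ?thesis using that closed by (simp add: lower_def)
    qed
    then show ?thesis
      using that by (auto simp: K_def plus_set_def take_Suc_conv_app_nth)
  qed
  have "K 0 = {mat 1}" using one by (auto simp: K_def)
  moreover have "K (length ss) = W" using ss by (auto simp: K_def)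
  moreover have "\<forall>i<length ss. \<exists>s\<in>S. K (Suc i) = plus_set W S (K i) s"
    using step ss(1) by (meson nth_mem subsetD)
  moreover have "\<forall>i\<le>length ss. K i \<subseteq> W" by (auto simp: K_def)
  ultimately show ?thesis by blast
qed

end
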